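(* Let $f=h+P$ on $\mathbb{R}^n$, where $h:\mathbb{R}^n\to\mathbb{R}$ is continuously differentiable and $\nabla h$ is globally Lipschitz continuous with Lipschitz constant $L>0$, and $P$ is a proper closed convex function. Suppose that $f$ is a coercive KL function with an exponent of $\frac12$. Let $\beta\in[0,1)$, $\alpha\in\left(0,\frac{2(1-\beta)}{L}\right)$, and let $\{x^k\}$ be a sequence generated by the inertial proximal algorithm (iPiano) with constant step-sizes: $x^{-1}=x^0$ and, for $k\ge0$, $$x^{k+1}=\arg\min_{x\in\mathbb{R}^n}\left\{\left\langle\nabla h(x^k)-\frac{\beta}{\alpha}(x^k-x^{k-1}),x-x^k\right\rangle+\frac{1}{2\alpha}\|x-x^k\|^2+P(x)\right\}.$$ Then $\{x^k\}$ converges locally linearly to a stationary point of $f$.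
   Context: Closed means lower semicontinuous; proper means never $-\infty$ and not identically $+\infty$; coercive means $f(x)\to\infty$ as $\|x\|\to\infty$. For a proper function $f$ and $x\in\mathrm{dom}\,f=\{x:f(x)<\infty\}$, the regular subdifferential is $\widehat\partial f(x)=\{v: \liminf_{z\to x,z\ne x}\frac{f(z)-f(x)-\langle v,z-x\rangle}{\|z-x\|}\ge 0\}$ and the (limiting) subdifferential $\partial f(x)$ is the set of $v$ for which there exist $x^t\to x$ with $f(x^t)\to f(x)$ and $v^t\to v$ with $v^t\in\widehat\partial f(x^t)$ for each $t$; $\partial f(x)=\emptyset$ if $x\notin\mathrm{dom}\,f$. $\mathrm{dom}\,\partial f=\{x:\partial f(x)\ne\emptyset\}$. A stationary point of $f$ is an $x$ with $0\in\partial f(x)$. A proper closed function $f$ has the KL property at $\bar x\in\mathrm{dom}\,\partial f$ with an exponent of $\alpha\in[0,1)$ if there exist $c,\epsilon>0$ and $\nu\in(0,\infty]$ such that $\mathrm{dist}(0,\partial f(x))\ge c\,(f(x)-f(\bar x))^\alpha$ whenever $\|x-\bar x\|\le\epsilon$ and $f(\bar x)<f(x)<f(\bar x)+\nu$ (with $\mathrm{dist}(0,\emptyset)=+\infty$). It is a KL function with an exponent of $\alpha$ if it has the KL property with exponent $\alpha$ at every $\bar x\in\mathrm{dom}\,\partial f$. "$\{x^k\}$ converges locally linearly to $\bar x$" means $R$-linear convergence: $x^k\to\bar x$ and $\limsup_{k\to\infty}\sqrt[k]{\|x^k-\bar x\|}<1$. *)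

theory Defs
  imports "HOL-Analysis.Analysis"
begin

definition proper_fun :: "('a \<Rightarrow> ereal) \<Rightarrow> bool" where
  "proper_fun f \<longleftrightarrow> (\<forall>x. f x \<noteq> -\<infinity>) \<and> (\<exists>x. f x \<noteq> \<infinity>)"

definition closed_fun :: "('a::topological_space \<Rightarrow> ereal) \<Rightarrow> bool" where
  "closed_fun f \<longleftrightarrow> (\<forall>x. f x \<le> Liminf (at x) f)"

(* Only used for functions that never take the value -\<infinity>, so the right-hand side is
   never of the form \<infinity> - \<infinity>; in ereal, 0 * \<infinity> = 0, so u = 0 or v = 0 is harmless. *)
definition convex_fun :: "('a::real_vector \<Rightarrow> ereal) \<Rightarrow> bool" where
  "convex_fun f \<longleftrightarrow>
     (\<forall>x y. \<forall>u\<ge>0. \<forall>v\<ge>0. u + v = (1::real) \<longrightarrow>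
        f (u *\<^sub>R x + v *\<^sub>R y) \<le> ereal u * f x + ereal v * f y)"

definition coercive_fun :: "('a::real_normed_vector \<Rightarrow> ereal) \<Rightarrow> bool" where
  "coercive_fun f \<longleftrightarrow> (f \<longlongrightarrow> \<infinity>) at_infinity"

definition effdom :: "('a \<Rightarrow> ereal) \<Rightarrow> 'a set" where
  "effdom f = {x. f x < \<infinity>}"

definition regular_subdiff :: "('a::real_inner \<Rightarrow> ereal) \<Rightarrow> 'a \<Rightarrow> 'a set" where
  "regular_subdiff f x =
     {v. x \<in> effdom f \<and>
         Liminf (at x) (\<lambda>z. (f z - f x - ereal (v \<bullet> (z - x))) / ereal (norm (z - x))) \<ge> 0}"

definition subdiff :: "('a::real_inner \<Rightarrow> ereal) \<Rightarrow> 'a \<Rightarrow> 'a set" where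
  "subdiff f x =
     {v. x \<in> effdom f \<and>
         (\<exists>xs vs. xs \<longlonglongrightarrow> x \<and> (\<lambda>t. f (xs t)) \<longlonglongrightarrow> f x \<and> vs \<longlonglongrightarrow> v \<and>
                  (\<forall>t::nat. vs t \<in> regular_subdiff f (xs t)))}"

definition dom_subdiff :: "('a::real_inner \<Rightarrow> ereal) \<Rightarrow> 'a set" where
  "dom_subdiff f = {x. subdiff f x \<noteq> {}}"

definition stationary_point :: "('a::real_inner \<Rightarrow> ereal) \<Rightarrow> 'a \<Rightarrow> bool" where
  "stationary_point f x \<longleftrightarrow> 0 \<in> subdiff f x"

(* Unlike the library's real-valued infdist, this gives \<infinity> for the empty set. *)
definition edist_to :: "'a::metric_space \<Rightarrow> 'a set \<Rightarrow> ereal" where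
  "edist_to x S = (INF y\<in>S. ereal (dist x y))"

(* For proper f and xbar in dom_subdiff f, the two strict inequalities make
   f x - f xbar a positive real, so real_of_ereal loses nothing. *)
definition KL_property :: "('a::real_inner \<Rightarrow> ereal) \<Rightarrow> 'a \<Rightarrow> real \<Rightarrow> bool" where
  "KL_property f xbar \<alpha> \<longleftrightarrow>
     xbar \<in> dom_subdiff f \<and> 0 \<le> \<alpha> \<and> \<alpha> < 1 \<and>
     (\<exists>c::real. \<exists>\<epsilon>::real. \<exists>\<nu>::ereal. c > 0 \<and> \<epsilon> > 0 \<and> \<nu> > 0 \<and>
        (\<forall>x. norm (x - xbar) \<le> \<epsilon> \<and> f xbar < f x \<and> f x < f xbar + \<nu> \<longrightarrow>
             edist_to 0 (subdiff f x) \<ge> ereal (c * real_of_ereal (f x - f xbar) powr \<alpha>)))"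

definition KL_function :: "('a::real_inner \<Rightarrow> ereal) \<Rightarrow> real \<Rightarrow> bool" where
  "KL_function f \<alpha> \<longleftrightarrow>
     proper_fun f \<and> closed_fun f \<and> (\<forall>xbar\<in>dom_subdiff f. KL_property f xbar \<alpha>)"

(* x k is the k-th iterate for k \<ge> 0; the convention that the iterate of index -1 equals x 0
   is built into the predecessor used in the extrapolation term.  The objective is strongly
   convex for proper convex P and \<alpha> > 0, so it has at most one minimizer. *)
definition iPiano_sequence ::
  "('a::real_inner \<Rightarrow> 'a) \<Rightarrow> ('a \<Rightarrow> ereal) \<Rightarrow> real \<Rightarrow> real \<Rightarrow> (nat \<Rightarrow> 'a) \<Rightarrow> bool" where
  "iPiano_sequence grad_h P \<alpha> \<beta> x \<longleftrightarrow>
     (\<forall>k. let xprev = (case k of 0 \<Rightarrow> x 0 | Suc j \<Rightarrow> x j) in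
        is_arg_min
          (\<lambda>z. ereal ((grad_h (x k) - (\<beta> / \<alpha>) *\<^sub>R (x k - xprev)) \<bullet> (z - x k)
                      + 1 / (2 * \<alpha>) * (norm (z - x k))\<^sup>2) + P z)
          (\<lambda>_. True) (x (Suc k)))"

definition converges_R_linearly :: "(nat \<Rightarrow> 'a::real_normed_vector) \<Rightarrow> 'a \<Rightarrow> bool" where
  "converges_R_linearly x xbar \<longleftrightarrow>
     x \<longlonglongrightarrow> xbar \<and> limsup (\<lambda>k. ereal (root k (norm (x k - xbar)))) < 1"

end

theory Submission
  imports Defs
begin

text \<open>
Write \<open>d\<^sub>k = \<parallel>x\<^sub>k\<^sub>+\<^sub>1 - x\<^sub>k\<parallel>\<close> and measure progress by the merit value
\<open>H\<^sub>k = f(x\<^sub>k\<^sub>+\<^sub>1) + \<delta> d\<^sub>k\<^sup>2\<close>.  The optimality condition of the proximal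
subproblem, the descent lemma for \<open>h\<close> and Young's inequality for the inertial cross term give
\<open>H\<^sub>k\<^sub>+\<^sub>1 \<le> H\<^sub>k - \<gamma> (d\<^sub>k\<^sub>+\<^sub>1\<^sup>2 + d\<^sub>k\<^sup>2)\<close>, where \<open>\<gamma> > 0\<close> is exactly the
restriction on the step size.  The same optimality condition produces a subgradient
\<open>w\<^sub>k\<close> of \<open>f\<close> at \<open>x\<^sub>k\<^sub>+\<^sub>2\<close> with \<open>\<parallel>w\<^sub>k\<parallel> \<le> A (d\<^sub>k\<^sub>+\<^sub>1 + d\<^sub>k)\<close>.

Coercivity bounds the iterates, so \<open>H\<close> decreases to a limit \<open>\<zeta>\<close>, the steps and the
subgradients tend to \<open>0\<close>, and \<open>f\<close> tends to \<open>\<zeta>\<close> along the sequence.  All these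
subgradients come with a quadratic minorant of \<open>f\<close> of the same curvature, which makes every
cluster point stationary with value exactly \<open>\<zeta>\<close>
(\<open>stationary_limit_of_proximal_subgradients\<close>).  The KL inequality therefore applies at every
cluster point, and a compactness argument turns it into
\<open>f(x\<^sub>k\<^sub>+\<^sub>2) - \<zeta> \<le> M \<parallel>w\<^sub>k\<parallel>\<^sup>2\<close> for all large \<open>k\<close>
(\<open>KL_half_along_bounded_sequence\<close>).

With exponent one half this estimate and the decrease of \<open>H\<close> are both quadratic in the steps:
\<open>H\<^sub>k\<^sub>+\<^sub>1 - \<zeta> \<le> N (d\<^sub>k\<^sub>+\<^sub>1\<^sup>2 + d\<^sub>k\<^sup>2) \<le> (N / \<gamma>) (H\<^sub>k - H\<^sub>k\<^sub>+\<^sub>1)\<close>.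
This contracts \<open>H - \<zeta>\<close> by a fixed factor (\<open>geometric_decrease\<close>), so the steps decay
geometrically and the iterates converge R-linearly.
\<close>

section \<open>Quadratic bounds for functions with Lipschitz gradient\<close>

lemma gradient_quadratic_upper_bound:
  fixes h :: "'a::real_inner \<Rightarrow> real"
  assumes grad: "\<And>z. GDERIV h z :> g z" and lip: "L-lipschitz_on UNIV g"
  shows "h z \<le> h a + g a \<bullet> (z - a) + L / 2 * (norm (z - a))\<^sup>2"
proof -
  \<comment> \<open>The defect of the bound along the segment from \<open>a\<close> to \<open>z\<close>; its derivative is nonpositive.\<close>
  define \<phi> where "\<phi> t = h (a + t *\<^sub>R (z - a)) - t * (g a \<bullet> (z - a)) - L / 2 * (t\<^sup>2 * (norm (z - a))\<^sup>2)" for t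
  have der: "(\<phi> has_real_derivative
      (z - a) \<bullet> g (a + t *\<^sub>R (z - a)) - g a \<bullet> (z - a) - L * t * (norm (z - a))\<^sup>2) (at t)" for t
  proof -
    have hd: "(h has_derivative (\<lambda>v. v \<bullet> g (a + t *\<^sub>R (z - a)))) (at (a + t *\<^sub>R (z - a)))"
      using grad by (simp add: gderiv_def)
    have "((\<lambda>t. h (a + t *\<^sub>R (z - a))) has_derivative (\<lambda>s. (s *\<^sub>R (z - a)) \<bullet> g (a + t *\<^sub>R (z - a)))) (at t)"
      by (rule has_derivative_compose[where f = "\<lambda>t. a + t *\<^sub>R (z - a)" and g = h, OF _ hd])
        (auto intro!: derivative_eq_intros)
    then have "((\<lambda>t. h (a + t *\<^sub>R (z - a))) has_real_derivative (z - a) \<bullet> g (a + t *\<^sub>R (z - a))) (at t)"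
      by (simp add: has_field_derivative_def mult.commute[of _ "_ \<bullet> _"])
    then show ?thesis
      unfolding \<phi>_def[abs_def] by (auto intro!: derivative_eq_intros)
  qed
  have "\<phi> 1 \<le> \<phi> 0"
  proof (rule DERIV_nonpos_imp_nonincreasing[of 0 1 \<phi>])
    fix t :: real assume t: "0 \<le> t" "t \<le> 1"
    have "(z - a) \<bullet> (g (a + t *\<^sub>R (z - a)) - g a)
        \<le> norm (z - a) * norm (g (a + t *\<^sub>R (z - a)) - g a)"
      by (rule norm_cauchy_schwarz)
    also have "\<dots> \<le> norm (z - a) * (L * norm (t *\<^sub>R (z - a)))"
      using lipschitz_onD[OF lip, of "a + t *\<^sub>R (z - a)" a]
      by (intro mult_left_mono) (auto simp: dist_norm)
    also have "\<dots> = L * t * (norm (z - a))\<^sup>2"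
      using t by (simp add: power2_eq_square)
    finally have "(z - a) \<bullet> g (a + t *\<^sub>R (z - a)) - g a \<bullet> (z - a) - L * t * (norm (z - a))\<^sup>2 \<le> 0"
      by (simp only: inner_diff_right[of "z - a"] inner_commute[of "g a"])
    with der[of t] show "\<exists>y. DERIV \<phi> t :> y \<and> y \<le> 0" by blast
  qed simp
  then show ?thesis by (simp add: \<phi>_def)
qed

lemma gradient_quadratic_lower_bound:
  fixes h :: "'a::real_inner \<Rightarrow> real"
  assumes grad: "\<And>z. GDERIV h z :> g z" and lip: "L-lipschitz_on UNIV g"
  shows "h a + g a \<bullet> (z - a) - L / 2 * (norm (z - a))\<^sup>2 \<le> h z"
proof -
  have "- h z \<le> - h a + (- g a) \<bullet> (z - a) + L / 2 * (norm (z - a))\<^sup>2"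
  proof (rule gradient_quadratic_upper_bound)
    show "GDERIV (\<lambda>z. - h z) z :> - g z" for z
      using grad by (rule GDERIV_minus)
    show "L-lipschitz_on UNIV (\<lambda>z. - g z)"
      using lip by (simp add: lipschitz_on_def dist_minus)
  qed
  then show ?thesis by simp
qed

section \<open>Subgradients from a proximal step\<close>

text \<open>
Fermat's rule for a quadratic plus a convex function: moving from the minimizer \<open>b\<close> a fraction
\<open>t\<close> towards \<open>z\<close> changes \<open>P\<close> by at most \<open>t (P z - P b)\<close> and the quadratic by its
linear part times \<open>t\<close> up to \<open>O(t\<^sup>2)\<close>.
\<close>
lemma proximal_step_subgradient:
  fixes P :: "'a::real_inner \<Rightarrow> ereal"
  assumes proper: "proper_fun P" and conv: "convex_fun P" and pos: "\<alpha> > 0"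
    and min: "is_arg_min (\<lambda>z. ereal (u \<bullet> (z - a) + 1 / (2 * \<alpha>) * (norm (z - a))\<^sup>2) + P z)
               (\<lambda>_. True) b"
  shows "P b \<noteq> \<infinity>" and "P b + ereal (- (u + (1 / \<alpha>) *\<^sub>R (b - a)) \<bullet> (z - b)) \<le> P z"
proof -
  have le: "ereal (u \<bullet> (b - a) + 1 / (2 * \<alpha>) * (norm (b - a))\<^sup>2) + P b
      \<le> ereal (u \<bullet> (z - a) + 1 / (2 * \<alpha>) * (norm (z - a))\<^sup>2) + P z" for z
    using min by (auto simp: is_arg_min_def not_less)
  have fin: "P z \<noteq> -\<infinity>" for z using proper by (auto simp: proper_fun_def)
  obtain y where "P y \<noteq> \<infinity>" using proper by (auto simp: proper_fun_def)
  then show "P b \<noteq> \<infinity>" using le[of y] by auto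
  then obtain pb where pb: "P b = ereal pb" using fin[of b] by (cases "P b") auto
  show "P b + ereal (- (u + (1 / \<alpha>) *\<^sub>R (b - a)) \<bullet> (z - b)) \<le> P z"
  proof (cases "P z")
    case (real pz)
    define D where "D = pb - pz - (u + (1 / \<alpha>) *\<^sub>R (b - a)) \<bullet> (z - b)"
    define K where "K = 1 / (2 * \<alpha>) * (norm (z - b))\<^sup>2"
    have bound: "D \<le> t * K" if t: "0 < t" "t < 1" for t
    proof -
      define c where "c = (1 - t) *\<^sub>R b + t *\<^sub>R z"
      have "P c \<le> ereal (1 - t) * P b + ereal t * P z"
        using conv t unfolding convex_fun_def c_def by auto
      then have "P c \<le> ereal ((1 - t) * pb + t * pz)" by (simp add: pb real)
      then have "ereal (u \<bullet> (b - a) + 1 / (2 * \<alpha>) * (norm (b - a))\<^sup>2) + P b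
          \<le> ereal (u \<bullet> (c - a) + 1 / (2 * \<alpha>) * (norm (c - a))\<^sup>2) + ereal ((1 - t) * pb + t * pz)"
        using le[of c] by (meson add_left_mono order_trans)
      then have *: "u \<bullet> (b - a) + 1 / (2 * \<alpha>) * (norm (b - a))\<^sup>2 + pb
          \<le> u \<bullet> (c - a) + 1 / (2 * \<alpha>) * (norm (c - a))\<^sup>2 + ((1 - t) * pb + t * pz)"
        by (simp add: pb)
      have ca: "c - a = (b - a) + t *\<^sub>R (z - b)" by (simp add: c_def algebra_simps)
      have n: "(norm (c - a))\<^sup>2 = (norm (b - a))\<^sup>2 + 2 * t * ((b - a) \<bullet> (z - b)) + t\<^sup>2 * (norm (z - b))\<^sup>2"
        unfolding ca power2_norm_eq_inner by (simp add: inner_add inner_commute power2_eq_square)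
      have i: "u \<bullet> (c - a) = u \<bullet> (b - a) + t * (u \<bullet> (z - b))"
        unfolding ca by (simp add: inner_add)
      have "t * D \<le> t * (t * K)"
        using * unfolding n i D_def K_def inner_add inner_scaleR_left
        by (simp add: algebra_simps power2_eq_square)
      then show ?thesis using t by simp
    qed
    have "D \<le> 0"
    proof (rule tendsto_lowerbound)
      show "((\<lambda>t. t * K) \<longlongrightarrow> 0) (at_right 0)"
        by (rule tendsto_eq_intros refl | simp)+
      show "\<forall>\<^sub>F t in at_right 0. D \<le> t * K"
        using bound by (auto simp: eventually_at_right_field intro!: exI[of _ 1])
    qed simp
    then show ?thesis unfolding pb real D_def inner_minus_left by simp
  qed (use fin in auto)
qed

text \<open>
A quadratic minorant touching \<open>f\<close> at \<open>a\<close> bounds the difference quotients from below by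
\<open>- c \<parallel>z - a\<parallel>\<close>.  A subgradient of a convex function plus the gradient of a function with
Lipschitz gradient comes with such a minorant of the sum.
\<close>
lemma proximal_subgradient_regular:
  fixes f :: "'a::real_inner \<Rightarrow> ereal"
  assumes fa: "f a = ereal r"
    and low: "\<And>z. ereal (r + v \<bullet> (z - a) - c * (norm (z - a))\<^sup>2) \<le> f z"
  shows "v \<in> regular_subdiff f a"
proof -
  have "0 \<le> Liminf (at a) (\<lambda>z. (f z - f a - ereal (v \<bullet> (z - a))) / ereal (norm (z - a)))"
  proof (cases "at a = bot")
    case True then show ?thesis by (simp add: top_ereal_def)
  next
    case False
    have "((\<lambda>z. ereal (- c * norm (z - a))) \<longlongrightarrow> ereal 0) (at a)"
      unfolding lim_ereal by (auto intro!: tendsto_eq_intros)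
    then have "0 = Liminf (at a) (\<lambda>z. ereal (- c * norm (z - a)))"
      using lim_imp_Liminf[OF False] by (metis zero_ereal_def)
    also have "\<dots> \<le> Liminf (at a) (\<lambda>z. (f z - f a - ereal (v \<bullet> (z - a))) / ereal (norm (z - a)))"
    proof (rule Liminf_mono)
      have "ereal (- c * norm (z - a)) \<le> (f z - f a - ereal (v \<bullet> (z - a))) / ereal (norm (z - a))"
        if "z \<noteq> a" for z
      proof (cases "f z")
        case (real s)
        have "r + v \<bullet> (z - a) - c * (norm (z - a))\<^sup>2 \<le> s" using low[of z] real by simp
        then show ?thesis using that by (simp add: real fa field_simps power2_eq_square)
      qed (use low[of z] fa that in auto)
      then show "\<forall>\<^sub>F z in at a. ereal (- c * norm (z - a))
          \<le> (f z - f a - ereal (v \<bullet> (z - a))) / ereal (norm (z - a))"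
        by (auto simp: eventually_at_filter)
    qed
    finally show ?thesis .
  qed
  then show ?thesis by (simp add: regular_subdiff_def effdom_def fa)
qed

lemma regular_subdiff_subset_subdiff: "regular_subdiff f a \<subseteq> subdiff f a"
proof
  fix v assume v: "v \<in> regular_subdiff f a"
  show "v \<in> subdiff f a"
    unfolding subdiff_def
  proof (intro CollectI conjI exI allI)
    show "a \<in> effdom f" using v by (simp add: regular_subdiff_def)
    show "(\<lambda>_. a) \<longlonglongrightarrow> a" "(\<lambda>_. f a) \<longlonglongrightarrow> f a" "(\<lambda>_. v) \<longlonglongrightarrow> v" by auto
  qed (rule v)
qed

section \<open>Limits of iterates\<close>

lemma closed_fun_le_limit:
  assumes cl: "closed_fun f" and s: "s \<longlonglongrightarrow> a" and fs: "(\<lambda>n. f (s n)) \<longlonglongrightarrow> l"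
  shows "f a \<le> (l :: ereal)"
proof (rule dense_le)
  fix y assume y: "y < f a"
  then have "\<forall>\<^sub>F z in at a. y < f z"
    using cl by (auto simp: closed_fun_def le_Liminf_iff)
  with y have "\<forall>\<^sub>F z in nhds a. y < f z"
    by (auto simp: eventually_nhds_conv_at)
  then have "\<forall>\<^sub>F n in sequentially. y \<le> f (s n)"
    using s unfolding filterlim_iff by (metis (mono_tags, lifting) eventually_mono less_imp_le)
  with fs show "y \<le> l" by (rule tendsto_lowerbound) simp
qed

text \<open>
Lower semicontinuity alone gives only \<open>f a \<le> \<zeta>\<close>.  The reverse inequality comes from
evaluating the minorants at \<open>a\<close>, and it needs their common curvature \<open>c\<close>.  This continuity
of \<open>f\<close> along the sequence is also what the limiting subdifferential demands.
\<close>
lemma stationary_limit_of_proximal_subgradients: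
  fixes f :: "'a::real_inner \<Rightarrow> ereal"
  assumes cl: "closed_fun f" and s: "s \<longlonglongrightarrow> a" and v: "v \<longlonglongrightarrow> 0"
    and fs: "\<And>n. f (s n) = ereal (F n)" and F: "F \<longlonglongrightarrow> \<zeta>"
    and low: "\<And>n z. ereal (F n + v n \<bullet> (z - s n) - c * (norm (z - s n))\<^sup>2) \<le> f z"
  shows "f a = ereal \<zeta>" and "stationary_point f a"
proof -
  have lim: "(\<lambda>n. f (s n)) \<longlonglongrightarrow> ereal \<zeta>" using F by (simp add: fs)
  have "(\<lambda>n. F n + v n \<bullet> (a - s n) - c * (norm (a - s n))\<^sup>2)
      \<longlonglongrightarrow> \<zeta> + 0 \<bullet> (a - a) - c * (norm (a - a))\<^sup>2"
    by (intro tendsto_intros F v s)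
  then have "(\<lambda>n. ereal (F n + v n \<bullet> (a - s n) - c * (norm (a - s n))\<^sup>2)) \<longlonglongrightarrow> ereal \<zeta>" by simp
  then have "ereal \<zeta> \<le> f a"
    by (rule tendsto_upperbound) (use low in auto)
  with closed_fun_le_limit[OF cl s lim] show fa: "f a = ereal \<zeta>" by simp
  have "v n \<in> regular_subdiff f (s n)" for n
    using fs low by (rule proximal_subgradient_regular)
  then show "stationary_point f a"
    unfolding stationary_point_def subdiff_def effdom_def using s v lim fa by auto
qed

section \<open>The KL inequality with exponent one half\<close>

text \<open>
The KL inequality squared.  In this form it holds trivially for values below \<open>\<zeta>\<close> as well, so
it covers iterates on both sides of the limit value.
\<close>
lemma KL_half_squared_subgradient_bound:
  fixes f :: "'a::real_inner \<Rightarrow> ereal"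
  assumes KL: "KL_property f a (1 / 2)" and fa: "f a = ereal \<zeta>"
  obtains M \<epsilon> \<eta> where "M > 0" "\<epsilon> > 0" "\<eta> > 0"
    "\<And>y r v. \<lbrakk>norm (y - a) \<le> \<epsilon>; f y = ereal r; r < \<zeta> + \<eta>; v \<in> subdiff f y\<rbrakk>
        \<Longrightarrow> r - \<zeta> \<le> M * (norm v)\<^sup>2"
proof -
  obtain c \<epsilon> \<nu> where c: "c > 0" and e: "\<epsilon> > 0" and nu: "(\<nu>::ereal) > 0"
    and kl: "\<And>y. norm (y - a) \<le> \<epsilon> \<Longrightarrow> f a < f y \<Longrightarrow> f y < f a + \<nu> \<Longrightarrow>
       edist_to 0 (subdiff f y) \<ge> ereal (c * real_of_ereal (f y - f a) powr (1/2))"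
    using KL unfolding KL_property_def by blast
  obtain \<eta> :: real where eta: "\<eta> > 0" "ereal \<eta> < \<nu>"
    using ereal_dense2[OF nu] by (metis ereal_less(2))
  show ?thesis
  proof (rule that[of "1 / c\<^sup>2" \<epsilon> \<eta>])
    fix y r v
    assume y: "norm (y - a) \<le> \<epsilon>" "f y = ereal r" "r < \<zeta> + \<eta>" "v \<in> subdiff f y"
    show "r - \<zeta> \<le> 1 / c\<^sup>2 * (norm v)\<^sup>2"
    proof (cases "\<zeta> < r")
      case True
      have "f y < f a + \<nu>"
        using y eta by (cases \<nu>) (auto simp: fa)
      then have "ereal (c * (r - \<zeta>) powr (1/2)) \<le> edist_to 0 (subdiff f y)"
        using kl[of y] y True by (simp add: fa)
      also have "\<dots> \<le> ereal (dist 0 v)"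
        unfolding edist_to_def using y(4) by (rule INF_lower)
      finally have "c * sqrt (r - \<zeta>) \<le> norm v"
        using True by (simp add: powr_half_sqrt)
      then have "(c * sqrt (r - \<zeta>))\<^sup>2 \<le> (norm v)\<^sup>2"
        using c True by (intro power_mono) auto
      then show ?thesis using c True by (simp add: power_mult_distrib field_simps)
    next
      case False
      then show ?thesis by (smt (verit) divide_nonneg_nonneg mult_nonneg_nonneg zero_le_power2)
    qed
  qed (use c e eta in auto)
qed

text \<open>
The KL constants depend on the cluster point, yet one \<open>M\<close> serves the whole tail.  Otherwise
there are iterates violating the bound with constants tending to infinity; they cluster at some
\<open>a\<close>, which is stationary with value \<open>\<zeta>\<close>, and the KL inequality at \<open>a\<close> gives a fixed
constant that they satisfy.
\<close>
lemma KL_half_along_bounded_sequence: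
  fixes f :: "'a::euclidean_space \<Rightarrow> ereal"
  assumes KL: "KL_function f (1 / 2)" and bdd: "bounded (range s)" and v: "v \<longlonglongrightarrow> 0"
    and fs: "\<And>n. f (s n) = ereal (F n)" and F: "F \<longlonglongrightarrow> \<zeta>"
    and low: "\<And>n z. ereal (F n + v n \<bullet> (z - s n) - c * (norm (z - s n))\<^sup>2) \<le> f z"
  obtains M where "M > 0" "\<forall>\<^sub>F n in sequentially. F n - \<zeta> \<le> M * (norm (v n))\<^sup>2"
proof (rule ccontr)
  assume neg: "\<not> thesis"
  have "\<exists>n\<ge>m. F n - \<zeta> > real (Suc m) * (norm (v n))\<^sup>2" for m
  proof (rule ccontr)
    assume "\<not> ?thesis"
    then have "\<forall>\<^sub>F n in sequentially. F n - \<zeta> \<le> real (Suc m) * (norm (v n))\<^sup>2"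
      by (meson eventually_sequentiallyI not_le)
    then show False using neg that[of "real (Suc m)"] by simp
  qed
  then obtain k where k: "\<And>m. k m \<ge> m"
    "\<And>m. F (k m) - \<zeta> > real (Suc m) * (norm (v (k m)))\<^sup>2" by metis
  have "bounded (range (\<lambda>m. s (k m)))" using bdd by (rule bounded_subset) auto
  then obtain a r where r: "strict_mono r" and lim: "((\<lambda>m. s (k m)) \<circ> r) \<longlonglongrightarrow> a"
    using bounded_imp_convergent_subsequence by blast
  define j where "j i = k (r i)" for i
  have jtop: "filterlim j at_top sequentially"
    using k(1) filterlim_subseq[OF r] unfolding j_def
    by (auto intro: filterlim_at_top_mono)
  have sj: "(\<lambda>i. s (j i)) \<longlonglongrightarrow> a" using lim by (simp add: j_def o_def)
  have Fj: "(\<lambda>i. F (j i)) \<longlonglongrightarrow> \<zeta>" using filterlim_compose[OF F jtop] .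
  have vj: "(\<lambda>i. v (j i)) \<longlonglongrightarrow> 0" using filterlim_compose[OF v jtop] .
  have cl: "closed_fun f" using KL by (simp add: KL_function_def)
  note st = stationary_limit_of_proximal_subgradients[OF cl sj vj fs Fj low]
  have "KL_property f a (1/2)"
    using KL st(2) by (auto simp: KL_function_def stationary_point_def dom_subdiff_def)
  then obtain M \<epsilon> \<eta> where M: "M > 0" "\<epsilon> > 0" "\<eta> > 0"
    and bound: "\<And>y r v. \<lbrakk>norm (y - a) \<le> \<epsilon>; f y = ereal r; r < \<zeta> + \<eta>; v \<in> subdiff f y\<rbrakk>
        \<Longrightarrow> r - \<zeta> \<le> M * (norm v)\<^sup>2"
    using st(1) by (rule KL_half_squared_subgradient_bound) blast
  have "\<forall>\<^sub>F i in sequentially. dist (s (j i)) a < \<epsilon>"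
    using sj M(2) by (rule tendstoD)
  moreover have "\<forall>\<^sub>F i in sequentially. F (j i) < \<zeta> + \<eta>"
    using Fj M(3) by (intro order_tendstoD) auto
  moreover have "\<forall>\<^sub>F i in sequentially. M \<le> real i"
    by (rule eventually_sequentiallyI[of "nat \<lceil>M\<rceil>"]) linarith
  ultimately have "\<forall>\<^sub>F i in sequentially. False"
  proof eventually_elim
    case (elim i)
    have "v (j i) \<in> subdiff f (s (j i))"
      using proximal_subgradient_regular[OF fs low] regular_subdiff_subset_subdiff by blast
    then have "F (j i) - \<zeta> \<le> M * (norm (v (j i)))\<^sup>2"
      using elim fs by (intro bound) (auto simp: dist_norm)
    also have "\<dots> \<le> real (Suc (r i)) * (norm (v (j i)))\<^sup>2"
      using elim seq_suble[OF r, of i] by (intro mult_right_mono) auto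
    also have "\<dots> < F (j i) - \<zeta>" using k(2)[of "r i"] by (simp add: j_def)
    finally show False by simp
  qed
  then show False by simp
qed

section \<open>Sufficient decrease and rates\<close>

lemma sufficient_decrease_converges:
  fixes H d :: "nat \<Rightarrow> real"
  assumes g: "\<gamma> > 0" and dec: "\<And>k. H (Suc k) \<le> H k - \<gamma> * ((d (Suc k))\<^sup>2 + (d k)\<^sup>2)"
    and low: "\<And>k. B \<le> H k"
  obtains \<zeta> where "H \<longlonglongrightarrow> \<zeta>" "\<And>k. \<zeta> \<le> H k" "d \<longlonglongrightarrow> 0"
proof -
  have step: "H (Suc k) \<le> H k" for k
    by (smt (verit) dec g mult_nonneg_nonneg zero_le_power2)
  then have "decseq H" by (rule decseq_SucI)
  then obtain \<zeta> where z: "H \<longlonglongrightarrow> \<zeta>" "\<And>k. \<zeta> \<le> H k"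
    using decseq_convergent[of H B] low by metis
  have "(\<lambda>k. (H k - H (Suc k)) / \<gamma>) \<longlonglongrightarrow> (\<zeta> - \<zeta>) / \<gamma>"
    using g by (intro tendsto_intros z LIMSEQ_Suc) auto
  then have lim: "(\<lambda>k. (H k - H (Suc k)) / \<gamma>) \<longlonglongrightarrow> 0" by simp
  have "(\<lambda>k. (d k)\<^sup>2) \<longlonglongrightarrow> 0"
  proof (rule tendsto_sandwich[OF _ _ tendsto_const lim])
    have "(d k)\<^sup>2 \<le> (H k - H (Suc k)) / \<gamma>" for k
    proof -
      have "\<gamma> * (d k)\<^sup>2 + \<gamma> * (d (Suc k))\<^sup>2 \<le> H k - H (Suc k)"
        using dec[of k] by (simp add: algebra_simps)
      moreover have "0 \<le> \<gamma> * (d (Suc k))\<^sup>2" using g by simp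
      ultimately have "(d k)\<^sup>2 * \<gamma> \<le> H k - H (Suc k)" by (simp add: mult.commute)
      then show ?thesis using g by (simp add: pos_le_divide_eq)
    qed
    then show "\<forall>\<^sub>F k in sequentially. (d k)\<^sup>2 \<le> (H k - H (Suc k)) / \<gamma>" by simp
  qed simp
  then have "d \<longlonglongrightarrow> 0" by simp
  with z show ?thesis by (rule that)
qed

text \<open>
The error bound and the decrease are both proportional to the same squared steps.  Eliminating
the steps contracts \<open>H - \<zeta>\<close> by the factor \<open>M / (M + \<gamma>)\<close>; the steps, whose squares are
bounded by \<open>(H - \<zeta>) / \<gamma>\<close>, then decay with the square root of this factor.
\<close>
lemma geometric_decrease:
  fixes H d :: "nat \<Rightarrow> real"
  assumes g: "\<gamma> > 0" and dec: "\<And>k. H (Suc k) \<le> H k - \<gamma> * ((d (Suc k))\<^sup>2 + (d k)\<^sup>2)"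
    and low: "\<And>k. \<zeta> \<le> H k" and M: "M > 0"
    and err: "\<And>k. k \<ge> K \<Longrightarrow> H (Suc k) - \<zeta> \<le> M * ((d (Suc k))\<^sup>2 + (d k)\<^sup>2)"
  obtains C q where "0 < q" "q < 1" "0 \<le> C" "\<And>k. k \<ge> K \<Longrightarrow> d k \<le> C * q ^ k"
proof -
  define \<rho> where "\<rho> = M / (M + \<gamma>)"
  have rho: "0 < \<rho>" "\<rho> < 1" using g M by (auto simp: \<rho>_def)
  have contr: "H (Suc k) - \<zeta> \<le> \<rho> * (H k - \<zeta>)" if "k \<ge> K" for k
  proof -
    define e where "e = (d (Suc k))\<^sup>2 + (d k)\<^sup>2"
    have "\<gamma> * (H (Suc k) - \<zeta>) \<le> M * (\<gamma> * e)"
      using mult_left_mono[OF err[OF that], of \<gamma>] g by (simp add: e_def mult_ac)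
    also have "\<dots> \<le> M * (H k - H (Suc k))"
      using dec[of k] M by (intro mult_left_mono) (auto simp: e_def)
    finally show ?thesis using g M by (simp add: \<rho>_def field_simps)
  qed
  define C0 where "C0 = (H K - \<zeta>) / \<rho> ^ K"
  have C0: "0 \<le> C0" using low rho by (simp add: C0_def)
  have geo: "H k - \<zeta> \<le> C0 * \<rho> ^ k" if "k \<ge> K" for k
    using that
  proof (induction rule: dec_induct)
    case base then show ?case using rho by (simp add: C0_def)
  next
    case (step k)
    then show ?case
      using contr[of k] mult_left_mono[OF step.IH, of \<rho>] rho by (simp add: algebra_simps)
  qed
  show ?thesis
  proof (rule that[of "sqrt \<rho>" "sqrt (C0 / \<gamma>)"])
    fix k assume k: "k \<ge> K"
    have "0 \<le> \<gamma> * (d (Suc k))\<^sup>2" using g by simp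
    then have "\<gamma> * (d k)\<^sup>2 \<le> H k - \<zeta>" using dec[of k] low[of "Suc k"] by (simp add: algebra_simps)
    also have "\<dots> \<le> C0 * \<rho> ^ k" using geo k by blast
    finally have "(d k)\<^sup>2 \<le> C0 / \<gamma> * \<rho> ^ k" using g by (simp add: field_simps)
    then have "d k \<le> sqrt (C0 / \<gamma> * \<rho> ^ k)" by (rule real_le_rsqrt)
    then show "d k \<le> sqrt (C0 / \<gamma>) * sqrt \<rho> ^ k" by (simp only: real_sqrt_mult real_sqrt_power)
  qed (use rho C0 g in auto)
qed

lemma geometric_steps_converge_R_linearly:
  fixes x :: "nat \<Rightarrow> 'a::banach"
  assumes q: "0 < q" "q < 1" and C: "0 \<le> C"
    and step: "\<And>k. k \<ge> K \<Longrightarrow> norm (x (Suc k) - x k) \<le> C * q ^ k"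
  obtains a where "converges_R_linearly x a"
proof -
  have "summable (\<lambda>k. x (Suc k) - x k)"
  proof (rule summable_comparison_test)
    show "\<exists>N. \<forall>n\<ge>N. norm (x (Suc n) - x n) \<le> C * q ^ n" using step by blast
    show "summable (\<lambda>n. C * q ^ n)" using q by (intro summable_mult summable_geometric) simp
  qed
  then have "convergent (\<lambda>n. \<Sum>k<n. x (Suc k) - x k)" by (simp add: summable_iff_convergent)
  then have "convergent (\<lambda>n. x n - x 0)" by (simp add: sum_lessThan_telescope)
  then obtain l where "(\<lambda>n. x n - x 0) \<longlonglongrightarrow> l" by (auto simp: convergent_def)
  from tendsto_add[OF this tendsto_const[of "x 0"]] obtain a where a: "x \<longlonglongrightarrow> a" by auto
  \<comment> \<open>\<open>D q\<^sup>k\<close> is the tail of the geometric series that dominates the remaining steps.\<close>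
  define D where "D = C / (1 - q)"
  have D: "0 \<le> D" using C q by (simp add: D_def)
  have tail: "norm (x (k + m) - x k) \<le> D * (q ^ k - q ^ (k + m))" if k: "k \<ge> K" for k m
  proof (induction m)
    case (Suc m)
    have "norm (x (k + Suc m) - x k) \<le> norm (x (Suc (k + m)) - x (k + m)) + norm (x (k + m) - x k)"
      using norm_triangle_ineq[of "x (Suc (k + m)) - x (k + m)" "x (k + m) - x k"] by simp
    also have "\<dots> \<le> C * q ^ (k + m) + D * (q ^ k - q ^ (k + m))"
      using Suc step[of "k + m"] k by (intro add_mono) auto
    also have "C = D * (1 - q)" using q by (simp add: D_def)
    finally show ?case by (simp add: algebra_simps)
  qed simp
  \<comment> \<open>\<open>D + 1\<close> instead of \<open>D\<close> keeps the constant positive, so that its \<open>k\<close>-th root tends to \<open>1\<close>.\<close>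
  have err: "norm (x k - a) \<le> (D + 1) * q ^ k" if k: "k \<ge> K" for k
  proof -
    have "(\<lambda>m. norm (x (m + k) - x k)) \<longlonglongrightarrow> norm (a - x k)"
      by (intro tendsto_intros LIMSEQ_ignore_initial_segment a)
    moreover have "norm (x (m + k) - x k) \<le> (D + 1) * q ^ k" for m
    proof -
      have "D * (q ^ k - q ^ (k + m)) \<le> D * q ^ k" using D q by (intro mult_left_mono) auto
      also have "\<dots> \<le> (D + 1) * q ^ k" using q by (simp add: algebra_simps)
      finally show ?thesis using tail[OF k, of m] by (simp add: add.commute)
    qed
    ultimately show ?thesis
      by (intro tendsto_upperbound[of _ _ sequentially]) (auto simp: norm_minus_commute)
  qed
  have lim: "(\<lambda>k. ereal (root k (D + 1) * q)) \<longlonglongrightarrow> ereal (1 * q)"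
    unfolding lim_ereal using D by (intro tendsto_intros LIMSEQ_root_const) auto
  have "limsup (\<lambda>k. ereal (root k (norm (x k - a)))) \<le> limsup (\<lambda>k. ereal (root k (D + 1) * q))"
  proof (rule Limsup_mono, rule eventually_sequentiallyI[of "Suc K"])
    fix k assume k: "Suc K \<le> k"
    have "root k (norm (x k - a)) \<le> root k ((D + 1) * q ^ k)"
      using err[of k] k by simp
    also have "\<dots> = root k (D + 1) * q"
      using k q by (simp add: real_root_mult real_root_power_cancel)
    finally show "ereal (root k (norm (x k - a))) \<le> ereal (root k (D + 1) * q)" by simp
  qed
  also have "\<dots> = ereal q" using lim_imp_Limsup[OF _ lim] by simp
  also have "\<dots> < 1" using q by simp
  finally show ?thesis using a by (intro that) (auto simp: converges_R_linearly_def)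
qed

lemma bounded_sublevel_sequence:
  fixes f :: "'a::real_normed_vector \<Rightarrow> ereal"
  assumes "coercive_fun f" and le: "\<And>n. f (s n) \<le> ereal B"
  shows "bounded (range s)"
proof -
  have "\<forall>\<^sub>F z in at_infinity. ereal B < f z"
    using assms(1) by (auto simp: coercive_fun_def intro: order_tendstoD(1))
  then obtain b where "\<And>z. norm z \<ge> b \<Longrightarrow> ereal B < f z" by (auto simp: eventually_at_infinity)
  then have "norm (s n) \<le> b" for n using le[of n] by (meson le_cases not_le)
  then show ?thesis by (auto simp: bounded_iff)
qed

section \<open>Convergence of inertial descent sequences\<close>

text \<open>
The part of the argument that is independent of how the sequence is generated.  The values
\<open>F k\<close> start at \<open>x (Suc 0)\<close> because the starting point may lie outside the effective domain,
and \<open>w k\<close> belongs to \<open>x (Suc (Suc k))\<close>, the end of the two steps that bound it.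
\<close>
lemma inertial_descent_converges_R_linearly:
  fixes f :: "'a::euclidean_space \<Rightarrow> ereal" and x :: "nat \<Rightarrow> 'a"
  defines "d \<equiv> \<lambda>k. norm (x (Suc k) - x k)"
  assumes coercive: "coercive_fun f" and KL: "KL_function f (1 / 2)"
    and g: "\<gamma> > 0" and del: "\<delta> \<ge> 0" and A: "A \<ge> 0" and c: "c \<ge> 0"
    and fx: "\<And>k. f (x (Suc k)) = ereal (F k)"
    and low: "\<And>k z. ereal (F (Suc k) + w k \<bullet> (z - x (Suc (Suc k)))
                 - c * (norm (z - x (Suc (Suc k))))\<^sup>2) \<le> f z"
    and wbound: "\<And>k. norm (w k) \<le> A * (d (Suc k) + d k)"
    and dec: "\<And>k. F (Suc k) + \<delta> * (d (Suc k))\<^sup>2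
                 \<le> F k + \<delta> * (d k)\<^sup>2 - \<gamma> * ((d (Suc k))\<^sup>2 + (d k)\<^sup>2)"
  shows "\<exists>xbar. stationary_point f xbar \<and> converges_R_linearly x xbar"
proof -
  define H where "H k = F k + \<delta> * (d k)\<^sup>2" for k
  have decH: "H (Suc k) \<le> H k - \<gamma> * ((d (Suc k))\<^sup>2 + (d k)\<^sup>2)" for k
    using dec by (simp add: H_def)
  have FH: "F k \<le> H k" for k using del by (simp add: H_def)
  have "H (Suc k) \<le> H k" for k
    by (smt (verit) decH g mult_nonneg_nonneg zero_le_power2)
  then have "decseq H" by (rule decseq_SucI)
  then have F0: "F k \<le> H 0" for k using FH[of k] decseqD[of H 0 k] by simp
  have bdd: "bounded (range (\<lambda>k. x (Suc k)))"
    using F0 by (intro bounded_sublevel_sequence[OF coercive, of _ "H 0"]) (simp add: fx)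
  then obtain R where R: "\<And>k. norm (x (Suc k)) \<le> R" by (auto simp: bounded_iff)
  \<comment> \<open>The first quadratic minorant is bounded below on the ball that contains the iterates.\<close>
  define B where "B = F 1 - norm (w 0) * (2 * R) - c * (2 * R)\<^sup>2"
  have "B \<le> H k" for k
  proof -
    define y where "y = x (Suc k) - x (Suc (Suc 0))"
    have y: "norm y \<le> 2 * R"
      using R[of k] R[of "Suc 0"] norm_triangle_ineq4[of "x (Suc k)" "x (Suc (Suc 0))"]
      unfolding y_def by linarith
    have "- (w 0 \<bullet> y) \<le> norm (w 0) * norm y" using norm_cauchy_schwarz[of "- w 0" y] by simp
    also have "\<dots> \<le> norm (w 0) * (2 * R)" using y by (intro mult_left_mono) auto
    finally have 1: "- (w 0 \<bullet> y) \<le> norm (w 0) * (2 * R)" .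
    have 2: "c * (norm y)\<^sup>2 \<le> c * (2 * R)\<^sup>2" using y c by (intro mult_left_mono power_mono) auto
    have "F 1 + w 0 \<bullet> y - c * (norm y)\<^sup>2 \<le> F k" using low[of 0 "x (Suc k)"] by (simp add: fx y_def)
    then show ?thesis using 1 2 FH[of k] unfolding B_def by linarith
  qed
  with g decH obtain \<zeta> where HZ: "H \<longlonglongrightarrow> \<zeta>" and lowH: "\<And>k. \<zeta> \<le> H k" and d0: "d \<longlonglongrightarrow> 0"
    by (rule sufficient_decrease_converges) blast
  have "(\<lambda>k. H k - \<delta> * (d k)\<^sup>2) \<longlonglongrightarrow> \<zeta> - \<delta> * 0\<^sup>2" by (intro tendsto_intros HZ d0)
  then have "F \<longlonglongrightarrow> \<zeta>" by (simp add: H_def)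
  then have FZ: "(\<lambda>k. F (Suc k)) \<longlonglongrightarrow> \<zeta>" by (rule LIMSEQ_Suc)
  have w0: "w \<longlonglongrightarrow> 0"
  proof (rule Lim_null_comparison)
    have "(\<lambda>k. A * (d (Suc k) + d k)) \<longlonglongrightarrow> A * (0 + 0)"
      by (intro tendsto_intros d0 LIMSEQ_Suc)
    then show "(\<lambda>k. A * (d (Suc k) + d k)) \<longlonglongrightarrow> 0" by simp
  qed (use wbound in auto)
  have "bounded (range (\<lambda>k. x (Suc (Suc k))))" using bdd by (rule bounded_subset) auto
  then obtain M where M: "M > 0"
    and ev: "\<forall>\<^sub>F k in sequentially. F (Suc k) - \<zeta> \<le> M * (norm (w k))\<^sup>2"
    by (rule KL_half_along_bounded_sequence[OF KL _ w0 fx FZ low]) blast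
  from ev obtain K where K: "\<And>k. k \<ge> K \<Longrightarrow> F (Suc k) - \<zeta> \<le> M * (norm (w k))\<^sup>2"
    by (auto simp: eventually_sequentially)
  \<comment> \<open>The summand \<open>1\<close> only ensures positivity, as required of the constant in the error bound.\<close>
  define N where "N = 2 * M * A\<^sup>2 + \<delta> + 1"
  have N: "N > 0" using M del by (simp add: N_def add_nonneg_pos)
  have err: "H (Suc k) - \<zeta> \<le> N * ((d (Suc k))\<^sup>2 + (d k)\<^sup>2)" if "k \<ge> K" for k
  proof -
    have "(norm (w k))\<^sup>2 \<le> (A * (d (Suc k) + d k))\<^sup>2" using wbound by (intro power_mono) auto
    also have "\<dots> = A\<^sup>2 * (d (Suc k) + d k)\<^sup>2" by (rule power_mult_distrib)
    also have "\<dots> \<le> A\<^sup>2 * (2 * ((d (Suc k))\<^sup>2 + (d k)\<^sup>2))"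
      using sum_squares_bound[of "d (Suc k)" "d k"] by (intro mult_left_mono) (auto simp: power2_sum)
    finally have "M * (norm (w k))\<^sup>2 \<le> M * (A\<^sup>2 * (2 * ((d (Suc k))\<^sup>2 + (d k)\<^sup>2)))"
      using M by (intro mult_left_mono) auto
    then have "F (Suc k) - \<zeta> \<le> 2 * M * A\<^sup>2 * ((d (Suc k))\<^sup>2 + (d k)\<^sup>2)"
      using K[OF that] by (simp add: algebra_simps)
    moreover have "\<delta> * (d (Suc k))\<^sup>2 \<le> \<delta> * ((d (Suc k))\<^sup>2 + (d k)\<^sup>2)"
      using del by (intro mult_left_mono) auto
    moreover have "0 \<le> (d (Suc k))\<^sup>2 + (d k)\<^sup>2" by simp
    ultimately show ?thesis unfolding H_def N_def by (simp only: distrib_right mult_1_left)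
  qed
  obtain C q where q: "0 < q" "q < 1" and C: "0 \<le> C" and geo: "\<And>k. k \<ge> K \<Longrightarrow> d k \<le> C * q ^ k"
    using geometric_decrease[where H = H and d = d, OF g decH lowH N err] by blast
  obtain xbar where lin: "converges_R_linearly x xbar"
    using geometric_steps_converge_R_linearly[OF q C, of K x] geo by (auto simp: d_def)
  then have "x \<longlonglongrightarrow> xbar" by (simp add: converges_R_linearly_def)
  then have "(\<lambda>k. x (Suc (Suc k))) \<longlonglongrightarrow> xbar" by (intro LIMSEQ_Suc)
  moreover have "closed_fun f" using KL by (simp add: KL_function_def)
  ultimately have "stationary_point f xbar"
    using stationary_limit_of_proximal_subgradients(2)[OF _ _ w0 fx FZ low] by blast
  with lin show ?thesis by blast
qed

theorem theorem5p1:
  fixes h :: "real ^ 'n \<Rightarrow> real"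
    and grad_h :: "real ^ 'n \<Rightarrow> real ^ 'n"
    and P f :: "real ^ 'n \<Rightarrow> ereal"
    and L \<alpha> \<beta> :: real
    and x :: "nat \<Rightarrow> real ^ 'n"
  assumes "\<And>z. GDERIV h z :> grad_h z"
    and "continuous_on UNIV grad_h"
    and "L > 0"
    and "L-lipschitz_on UNIV grad_h"
    and "proper_fun P" and "closed_fun P" and "convex_fun P"
    and "f = (\<lambda>z. ereal (h z) + P z)"
    and "coercive_fun f"
    and "KL_function f (1 / 2)"
    and "0 \<le> \<beta>" and "\<beta> < 1"
    and "0 < \<alpha>" and "\<alpha> < 2 * (1 - \<beta>) / L"
    and "iPiano_sequence grad_h P \<alpha> \<beta> x"
  shows "\<exists>xbar. stationary_point f xbar \<and> converges_R_linearly x xbar"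
proof -
  note grad = assms(1) and L = \<open>L > 0\<close> and lip = assms(4) and f = assms(8)
  define \<Delta> where "\<Delta> k = x (Suc k) - x k" for k
  define d where "d k = norm (\<Delta> k)" for k
  \<comment> \<open>Optimality of the initial step shows that \<open>x (Suc 0)\<close> is in the effective domain of \<open>P\<close>;
     \<open>x 0\<close> itself may lie outside.\<close>
  have min0: "is_arg_min (\<lambda>z. ereal ((grad_h (x 0) - (\<beta> / \<alpha>) *\<^sub>R 0) \<bullet> (z - x 0)
       + 1 / (2 * \<alpha>) * (norm (z - x 0))\<^sup>2) + P z) (\<lambda>_. True) (x (Suc 0))"
    using assms(15)[unfolded iPiano_sequence_def, rule_format, of 0] by simp
  have min: "is_arg_min (\<lambda>z. ereal ((grad_h (x (Suc k)) - (\<beta> / \<alpha>) *\<^sub>R \<Delta> k) \<bullet> (z - x (Suc k))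
       + 1 / (2 * \<alpha>) * (norm (z - x (Suc k)))\<^sup>2) + P z) (\<lambda>_. True) (x (Suc (Suc k)))" for k
    using assms(15)[unfolded iPiano_sequence_def, rule_format, of "Suc k"] by (simp add: \<Delta>_def)
  note prox = proximal_step_subgradient[OF \<open>proper_fun P\<close> \<open>convex_fun P\<close> \<open>0 < \<alpha>\<close>]
  have Pp: "P (x (Suc k)) \<noteq> \<infinity>" for k
    using prox(1)[OF min0] prox(1)[OF min] by (cases k) auto
  have Pm: "P z \<noteq> -\<infinity>" for z using \<open>proper_fun P\<close> by (auto simp: proper_fun_def)
  define p where "p k = real_of_ereal (P (x (Suc k)))" for k
  have Px: "P (x (Suc k)) = ereal (p k)" for k
    using Pp[of k] Pm[of "x (Suc k)"] by (cases "P (x (Suc k))") (auto simp: p_def)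
  define F where "F k = h (x (Suc k)) + p k" for k
  have fx: "f (x (Suc k)) = ereal (F k)" for k by (simp add: f F_def Px)
  \<comment> \<open>The convex subgradient of \<open>P\<close> at the new iterate; adding the gradient of \<open>h\<close> there gives one of \<open>f\<close>.\<close>
  define u where "u k = - (grad_h (x (Suc k)) - (\<beta> / \<alpha>) *\<^sub>R \<Delta> k + (1 / \<alpha>) *\<^sub>R \<Delta> (Suc k))" for k
  have sub: "ereal (p (Suc k) + u k \<bullet> (z - x (Suc (Suc k)))) \<le> P z" for k z
    using prox(2)[OF min, of k z] by (simp add: Px u_def \<Delta>_def)
  define w where "w k = grad_h (x (Suc (Suc k))) + u k" for k
  have low: "ereal (F (Suc k) + w k \<bullet> (z - x (Suc (Suc k))) - L / 2 * (norm (z - x (Suc (Suc k))))\<^sup>2) \<le> f z"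
    for k z
  proof (cases "P z")
    case (real r)
    have "p (Suc k) + u k \<bullet> (z - x (Suc (Suc k))) \<le> r" using sub[of k z] real by simp
    then show ?thesis
      using gradient_quadratic_lower_bound[OF grad lip, of "x (Suc (Suc k))" z]
      by (simp add: f real F_def w_def inner_add)
  qed (use Pm f in auto)
  define A where "A = L + 1 / \<alpha> + \<beta> / \<alpha>"
  have A: "A > 0" using L \<open>0 \<le> \<beta>\<close> \<open>0 < \<alpha>\<close> by (simp add: A_def add_pos_nonneg)
  have wbound: "norm (w k) \<le> A * (d (Suc k) + d k)" for k
  proof -
    have eq: "w k = (grad_h (x (Suc (Suc k))) - grad_h (x (Suc k))) + (\<beta> / \<alpha>) *\<^sub>R \<Delta> k - (1 / \<alpha>) *\<^sub>R \<Delta> (Suc k)"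
      by (simp add: w_def u_def)
    have 1: "norm (grad_h (x (Suc (Suc k))) - grad_h (x (Suc k))) \<le> L * d (Suc k)"
      using lipschitz_onD[OF lip, of "x (Suc (Suc k))" "x (Suc k)"] by (simp add: dist_norm d_def \<Delta>_def)
    have "norm (w k) \<le> norm (grad_h (x (Suc (Suc k))) - grad_h (x (Suc k)))
        + norm ((\<beta> / \<alpha>) *\<^sub>R \<Delta> k) + norm ((1 / \<alpha>) *\<^sub>R \<Delta> (Suc k))"
      unfolding eq by (meson norm_triangle_ineq norm_triangle_ineq4 add_right_mono order_trans)
    also have "\<dots> \<le> (L + 1 / \<alpha>) * d (Suc k) + \<beta> / \<alpha> * d k"
      using 1 \<open>0 < \<alpha>\<close> \<open>0 \<le> \<beta>\<close> by (simp add: d_def algebra_simps)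
    also have "\<dots> \<le> A * d (Suc k) + A * d k"
      using L \<open>0 \<le> \<beta>\<close> \<open>0 < \<alpha>\<close> by (intro add_mono mult_right_mono) (auto simp: A_def d_def)
    finally show ?thesis by (simp only: distrib_left)
  qed
  \<comment> \<open>Young's inequality charges the cross term \<open>(\<beta> / \<alpha>) \<Delta>\<^sub>k \<bullet> \<Delta>\<^sub>k\<^sub>+\<^sub>1\<close> equally to both steps.
     The new step then has the budget \<open>1 / \<alpha> - L / 2 - \<beta> / (2 \<alpha>)\<close> and the old one the debt
     \<open>\<beta> / (2 \<alpha>)\<close>; \<open>\<delta>\<close> is their midpoint, at distance \<open>\<gamma>\<close> from both.\<close>
  define \<gamma> where "\<gamma> = ((1 - \<beta>) / \<alpha> - L / 2) / 2"
  have g: "\<gamma> > 0" using assms(14) L \<open>0 < \<alpha>\<close> by (simp add: \<gamma>_def field_simps)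
  define \<delta> where "\<delta> = \<beta> / (2 * \<alpha>) + \<gamma>"
  have del: "\<delta> > 0" using g \<open>0 \<le> \<beta>\<close> \<open>0 < \<alpha>\<close> by (simp add: \<delta>_def add_nonneg_pos)
  have dec: "F (Suc k) + \<delta> * (d (Suc k))\<^sup>2
      \<le> F k + \<delta> * (d k)\<^sup>2 - \<gamma> * ((d (Suc k))\<^sup>2 + (d k)\<^sup>2)" for k
  proof -
    have Psub: "p (Suc k) - u k \<bullet> \<Delta> (Suc k) \<le> p k"
      using sub[of k "x (Suc k)"] by (simp add: Px \<Delta>_def inner_diff)
    have desc: "h (x (Suc (Suc k))) \<le> h (x (Suc k)) + grad_h (x (Suc k)) \<bullet> \<Delta> (Suc k) + L / 2 * (d (Suc k))\<^sup>2"
      using gradient_quadratic_upper_bound[OF grad lip, of "x (Suc (Suc k))" "x (Suc k)"]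
      by (simp add: \<Delta>_def d_def)
    have "u k \<bullet> \<Delta> (Suc k) = - (grad_h (x (Suc k)) \<bullet> \<Delta> (Suc k)) + \<beta> / \<alpha> * (\<Delta> k \<bullet> \<Delta> (Suc k)) - 1 / \<alpha> * (d (Suc k))\<^sup>2"
      by (simp add: u_def d_def inner_diff inner_add power2_norm_eq_inner)
    with Psub desc have A: "F (Suc k) \<le> F k + \<beta> / \<alpha> * (\<Delta> k \<bullet> \<Delta> (Suc k)) + (L / 2 - 1 / \<alpha>) * (d (Suc k))\<^sup>2"
      by (simp add: F_def algebra_simps)
    have "\<Delta> k \<bullet> \<Delta> (Suc k) \<le> d k * d (Suc k)" unfolding d_def by (rule norm_cauchy_schwarz)
    also have "\<dots> \<le> ((d k)\<^sup>2 + (d (Suc k))\<^sup>2) / 2"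
      using sum_squares_bound[of "d k" "d (Suc k)"] by simp
    finally have "\<beta> / \<alpha> * (\<Delta> k \<bullet> \<Delta> (Suc k)) \<le> \<beta> / \<alpha> * (((d k)\<^sup>2 + (d (Suc k))\<^sup>2) / 2)"
      using \<open>0 \<le> \<beta>\<close> \<open>0 < \<alpha>\<close> by (intro mult_left_mono) auto
    with A have B: "F (Suc k) \<le> F k + \<beta> / \<alpha> * (((d k)\<^sup>2 + (d (Suc k))\<^sup>2) / 2) + (L / 2 - 1 / \<alpha>) * (d (Suc k))\<^sup>2"
      by linarith
    define b where "b = \<beta> / \<alpha>"
    have "L / 2 - 1 / \<alpha> = - 2 * \<gamma> - b" "\<delta> = b / 2 + \<gamma>"
      using \<open>0 < \<alpha>\<close> by (auto simp: \<gamma>_def \<delta>_def b_def field_simps)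
    with B[folded b_def] show ?thesis by (simp add: algebra_simps add_divide_distrib)
  qed
  show ?thesis
    using inertial_descent_converges_R_linearly[where c = "L / 2" and w = w and x = x and F = F
        and A = A and \<gamma> = \<gamma> and \<delta> = \<delta>, OF \<open>coercive_fun f\<close> \<open>KL_function f (1/2)\<close> g]
      del A L fx low wbound dec unfolding d_def \<Delta>_def by simp
qed

end
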